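(* Let $G=(V,E)$ be a connected graph on $n=|V|$ vertices, with Laplacian eigenvalues $\lambda_1\ge\lambda_2\ge\cdots\ge\lambda_n(=0)$. For any given vertex subset $U=\{u_1,\ldots,u_m\}\subset V$ with $|U|=m$ and $0<m<n$, we have $$\sum_{i=1}^{m}\lambda_i\;\ge\;\sum_{u\in U}d_u+\frac{|\partial(U,\overline{U})|}{|\partial U|}.$$
   Context: All graphs are finite and simple. The Laplacian eigenvalues of $G$ are the eigenvalues (with multiplicity) of $L=D-A$, where $D$ is the diagonal matrix of vertex degrees and $A$ is the adjacency matrix. $d_u$ is the degree in $G$ of the vertex $u$. $\overline{U}=V\setminus U$; $\partial U$ is the vertex-boundary of $U$, that is, the set of vertices in $\overline{U}$ with at least one adjacent vertex in $U$; $\partial(U,\overline{U})$ is the edge-boundary of $U$, that is, the set of edges of $G$ connecting a vertex of $U$ with a vertex of $\overline{U}$. *)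

theory Defs
  imports "Graph_Theory.Pair_Digraph" "Graph_Theory.Digraph_Component"
    "Jordan_Normal_Form.Char_Poly"
begin

text \<open>
  A finite simple graph is a \<^locale>\<open>pair_graph\<close>: a finite vertex set with a symmetric,
  loop-free arc relation, an edge \<open>uv\<close> being the pair of arcs \<open>(u, v)\<close> and \<open>(v, u)\<close>.
  Hence the degree of a vertex is its \<^const>\<open>out_degree\<close>, whereas sets of edges have to be
  counted as sets of unordered pairs.
\<close>

definition vertex_boundary :: "'a pair_pre_digraph \<Rightarrow> 'a set \<Rightarrow> 'a set" where
  "vertex_boundary G U = {v \<in> pverts G - U. \<exists>u\<in>U. (u, v) \<in> parcs G}"

definition edge_boundary :: "'a pair_pre_digraph \<Rightarrow> 'a set \<Rightarrow> 'a set set" where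
  "edge_boundary G U = {{u, v} | u v. u \<in> U \<and> v \<in> pverts G - U \<and> (u, v) \<in> parcs G}"

text \<open>Matrices are taken with respect to a numbering \<open>vs\<close> of the vertices.\<close>

definition vertex_numbering :: "'a pair_pre_digraph \<Rightarrow> 'a list \<Rightarrow> bool" where
  "vertex_numbering G vs \<longleftrightarrow> distinct vs \<and> set vs = pverts G"

definition degree_mat :: "'a pair_pre_digraph \<Rightarrow> 'a list \<Rightarrow> real mat" where
  "degree_mat G vs = mat (length vs) (length vs)
     (\<lambda>(i, j). if i = j then real (out_degree (with_proj G) (vs ! i)) else 0)"

definition adjacency_mat :: "'a pair_pre_digraph \<Rightarrow> 'a list \<Rightarrow> real mat" where
  "adjacency_mat G vs = mat (length vs) (length vs)
     (\<lambda>(i, j). if (vs ! i, vs ! j) \<in> parcs G then 1 else 0)"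

definition laplacian_mat :: "'a pair_pre_digraph \<Rightarrow> 'a list \<Rightarrow> real mat" where
  "laplacian_mat G vs = degree_mat G vs - adjacency_mat G vs"

text \<open>
  The eigenvalues with multiplicity are the roots of the characteristic polynomial with
  multiplicity. As the Laplacian matrix is real symmetric, all of its eigenvalues are real, so the
  real roots are the complete spectrum, and algebraic and geometric multiplicities agree.
  \<open>laplacian_eigenvalue G vs i\<close> is the \<open>i\<close>-th largest one, counted from \<open>i = 1\<close>.
\<close>

definition laplacian_eigenvalue :: "'a pair_pre_digraph \<Rightarrow> 'a list \<Rightarrow> nat \<Rightarrow> real" where
  "laplacian_eigenvalue G vs i =
     rev (sorted_list_of_multiset (proots (char_poly (laplacian_mat G vs)))) ! (i - 1)"

end

theory Submission
  imports Defs "Jordan_Normal_Form.Schur_Decomposition" "HOL-Analysis.Convex"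
begin

text \<open>
  By Ky Fan's principle the sum of the \<open>m\<close> largest eigenvalues of a real symmetric matrix \<open>L\<close> is at
  least the trace of \<open>L\<close> compressed to any subspace of dimension \<open>m\<close>. The coordinate subspace of
  \<open>U\<close> yields the sum of the degrees. To gain the additional term, let \<open>B\<close> be the vertex boundary
  of \<open>U\<close>, with \<open>b\<close> elements, and add the normalised indicator vector of \<open>B\<close>. The trace grows by
  \<open>e(B, V - B) / b\<close>, where \<open>e\<close> counts edges between sets of vertices, but the dimension grows to
  \<open>m + 1\<close>. The enlarged space contains the indicator vector of \<open>U \<union> B\<close>; passing to the orthogonal
  complement of this vector brings the dimension back to \<open>m\<close> and lowers the trace by
  \<open>e(U \<union> B, W) / (m + b)\<close>, where \<open>W\<close> consists of the vertices outside \<open>U \<union> B\<close>.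

  Vertices of \<open>U\<close> have no neighbours in \<open>W\<close>, so \<open>e(B, V - B) = e(B, U) + e(B, W)\<close> and
  \<open>e(U \<union> B, W) = e(B, W)\<close>. As \<open>e(B, W) / b \<ge> e(B, W) / (m + b)\<close>, at least \<open>e(B, U) / b\<close> remains,
  and \<open>e(B, U)\<close> is the size of the edge boundary of \<open>U\<close>. Connectedness guarantees that \<open>B\<close> is
  not empty.

  The trace bound is \<open>ky_fan_trace_bound\<close>, which rests on the spectral theorem
  \<open>real_symmetric_diagonalization\<close>; the subspace enters through its projection
  \<open>aggregation_mat\<close>, and the edges are counted in \<open>laplacian_eigenvalue_sum_ge\<close>.
\<close>

(* Frees the infix dot for the scalar product of vectors of type vec. *)
unbundle no inner_syntax

section \<open>The spectral theorem for real symmetric matrices\<close>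

text \<open>
  A complex root \<open>a\<close> of the characteristic polynomial, with complex eigenvector \<open>v\<close>, satisfies
  \<open>a \<langle>v, v\<rangle> = \<langle>A v, v\<rangle> = \<langle>v, A v\<rangle> = cnj a \<langle>v, v\<rangle>\<close> and is therefore real; a real root then has a
  real eigenvector.
\<close>

lemma real_symmetric_real_eigenvector:
  fixes A :: "real mat"
  assumes A: "A \<in> carrier_mat n n" and sym: "transpose_mat A = A" and "n \<noteq> 0"
  obtains e v where "eigenvector A v e"
proof -
  let ?B = "map_mat complex_of_real A"
  have B: "?B \<in> carrier_mat n n" using A by simp
  obtain as where as: "char_poly ?B = (\<Prod>a\<leftarrow>as. [:- a, 1:])" "length as = n"
    using char_poly_factorized[OF B] by blast
  then obtain a as' where "as = a # as'" using \<open>n \<noteq> 0\<close> by (cases as) auto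
  then have root: "poly (char_poly ?B) a = 0" using as by simp
  then obtain v where "eigenvector ?B v a"
    using eigenvalue_root_char_poly[OF B] unfolding eigenvalue_def by blast
  then have v: "v \<in> carrier_vec n" "v \<noteq> 0\<^sub>v n" and Bv: "?B *\<^sub>v v = a \<cdot>\<^sub>v v"
    using A unfolding eigenvector_def by auto
  have "transpose_mat ?B = ?B" using sym by (metis map_mat_transpose)
  then have "(?B *\<^sub>v v) \<bullet>c v = v \<bullet> (?B *\<^sub>v conjugate v)"
    using transpose_vec_mult_scalar[OF B, of "conjugate v" v] v B
    by (metis carrier_vec_conjugate comm_scalar_prod mult_mat_vec_carrier)
  moreover have "?B *\<^sub>v conjugate v = conjugate (?B *\<^sub>v v)"
    using v A by (intro eq_vecI) (auto simp: scalar_prod_def)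
  ultimately have "a * (v \<bullet>c v) = cnj a * (v \<bullet>c v)"
    using v unfolding Bv by (simp add: conjugate_smult_vec)
  moreover have "v \<bullet>c v \<noteq> 0" using v by (metis conjugate_square_eq_0_vec)
  ultimately have "cnj a = a" by simp
  then obtain r where r: "a = complex_of_real r" using Reals_cnj_iff Reals_cases by metis
  have "poly (char_poly A) r = 0"
    using root unfolding r of_real_hom.char_poly_hom[OF A] by simp
  then show ?thesis
    using that eigenvalue_root_char_poly[OF A] unfolding eigenvalue_def by blast
qed

text \<open>
  Gram-Schmidt keeps the first vector of the basis that it is given, so it is enough to complete
  \<open>v\<close> to a basis, to orthogonalise, and to normalise at the end.
\<close>

lemma orthogonal_matrix_with_first_column:
  fixes v :: "real vec"
  assumes v: "v \<in> carrier_vec n" "v \<noteq> 0\<^sub>v n" and n: "n \<noteq> 0"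
  obtains W c where "W \<in> carrier_mat n n" "transpose_mat W * W = 1\<^sub>m n" "col W 0 = c \<cdot>\<^sub>v v"
proof -
  interpret cof_vec_space n "TYPE(real)" .
  define b where "b = basis_completion v"
  define ws where "ws = gram_schmidt n b"
  from basis_completion[OF v, folded b_def]
  have dist_b: "distinct b" and indep: "\<not> lin_dep (set b)" and b: "set b \<subseteq> carrier_vec n"
    and hdb: "hd b = v" and len_b: "length b = n" by auto
  from hdb len_b n obtain vs where bv: "b = v # vs" by (cases b) auto
  from gram_schmidt_result[OF b dist_b indep refl, folded ws_def]
  have ws: "set ws \<subseteq> carrier_vec n" "corthogonal ws" "length ws = n"
    by (auto simp: len_b)
  from gram_schmidt_hd[OF v(1), of vs, folded bv] have hdws: "hd ws = v" unfolding ws_def .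
  have conj_id: "conjugate x = x" for x :: "real vec" by (intro eq_vecI) auto
  have orth: "(ws ! i \<bullet> ws ! j = 0) = (i \<noteq> j)" if "i < n" "j < n" for i j
    using corthogonalD[OF ws(2), of i j] that ws(3) by (simp add: conj_id)
  have dims: "ws ! i \<in> carrier_vec n" if "i < n" for i using ws that by auto
  define u where "u i = (1 / sqrt (ws ! i \<bullet> ws ! i)) \<cdot>\<^sub>v ws ! i" for i
  have u: "u i \<in> carrier_vec n" if "i < n" for i using dims[OF that] by (simp add: u_def)
  define W where "W = mat_of_cols n (map u [0..<n])"
  have W: "W \<in> carrier_mat n n" unfolding W_def by (metis length_map length_upt mat_of_cols_carrier(1) minus_nat.diff_0)
  have colW: "col W i = u i" if "i < n" for i
    unfolding W_def using that u by (subst col_mat_of_cols) auto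
  have uu: "u i \<bullet> u j = (if i = j then 1 else 0)" if "i < n" "j < n" for i j
  proof -
    have pos: "ws ! i \<bullet> ws ! i \<ge> 0" by (simp add: scalar_prod_def sum_nonneg)
    have "u i \<bullet> u j = (1 / sqrt (ws ! i \<bullet> ws ! i)) * ((1 / sqrt (ws ! j \<bullet> ws ! j)) * (ws ! i \<bullet> ws ! j))"
      unfolding u_def using dims[OF that(1)] dims[OF that(2)] by simp
    then show ?thesis using orth[OF that] orth[OF that(1) that(1)] pos by auto
  qed
  have "transpose_mat W * W = 1\<^sub>m n"
    using W by (intro eq_matI) (auto simp: colW uu)
  moreover have "col W 0 = (1 / sqrt (ws ! 0 \<bullet> ws ! 0)) \<cdot>\<^sub>v v"
    using n colW[of 0] hdws ws(3) unfolding u_def by (cases ws) auto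
  ultimately show ?thesis using that W by blast
qed

text \<open>
  The spectral theorem by induction on the size: changing to an orthonormal basis that starts with
  an eigenvector produces a matrix whose first column, and by symmetry first row, vanishes off the
  diagonal. The remaining block is symmetric, and its diagonalization extends by one coordinate.
\<close>

theorem real_symmetric_diagonalization:
  fixes A :: "real mat"
  assumes "A \<in> carrier_mat n n" and "transpose_mat A = A"
  shows "\<exists>Q D. Q \<in> carrier_mat n n \<and> D \<in> carrier_mat n n \<and> diagonal_mat D \<and>
    transpose_mat Q * Q = 1\<^sub>m n \<and> A = Q * D * transpose_mat Q"
  using assms
proof (induction n arbitrary: A)
  case 0
  then show ?case
    by (intro exI[of _ "1\<^sub>m 0"] exI[of _ A]) (auto simp: diagonal_mat_def intro!: eq_matI)
next
  case (Suc k)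
  let ?n = "Suc k"
  note A = Suc.prems(1) and sym = Suc.prems(2)
  obtain e v where "eigenvector A v e"
    using real_symmetric_real_eigenvector[OF A sym] by blast
  then have v: "v \<in> carrier_vec ?n" "v \<noteq> 0\<^sub>v ?n" and Av: "A *\<^sub>v v = e \<cdot>\<^sub>v v"
    using A unfolding eigenvector_def by auto
  obtain W c where W: "W \<in> carrier_mat ?n ?n" and WW: "transpose_mat W * W = 1\<^sub>m ?n"
    and W0: "col W 0 = c \<cdot>\<^sub>v v"
    using orthogonal_matrix_with_first_column[OF v] by blast
  let ?A' = "transpose_mat W * A * W"
  have WT: "transpose_mat W \<in> carrier_mat ?n ?n" using W by simp
  have WW': "W * transpose_mat W = 1\<^sub>m ?n" using mat_mult_left_right_inverse[OF WT W WW] .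
  have A': "?A' \<in> carrier_mat ?n ?n" using W A by simp
  have symA': "transpose_mat ?A' = ?A'"
    using W A sym by (simp add: transpose_mult[of _ ?n ?n _ ?n])
  have AW0: "col (A * W) 0 = e \<cdot>\<^sub>v col W 0"
  proof -
    have "col (A * W) 0 = A *\<^sub>v (c \<cdot>\<^sub>v v)" using col_mult2[OF A W, of 0] W0 by simp
    also have "\<dots> = c \<cdot>\<^sub>v (e \<cdot>\<^sub>v v)" using mult_mat_vec[OF A v(1)] Av by simp
    also have "\<dots> = e \<cdot>\<^sub>v col W 0" unfolding W0 by (simp add: smult_smult_assoc mult.commute)
    finally show ?thesis .
  qed
  have col0: "?A' $$ (i, 0) = (if i = 0 then e else 0)" if i: "i < ?n" for i
  proof -
    have "?A' = transpose_mat W * (A * W)" using W A by (intro assoc_mult_mat) auto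
    then have "?A' $$ (i, 0) = col W i \<bullet> col (A * W) 0" using i A W by simp
    also have "\<dots> = e * (col W i \<bullet> col W 0)" unfolding AW0 using W by simp
    also have "col W i \<bullet> col W 0 = (transpose_mat W * W) $$ (i, 0)" using i W by simp
    also have "\<dots> = (if i = 0 then 1 else 0)" unfolding WW using i by simp
    finally show ?thesis by simp
  qed
  define A3 where "A3 = mat k k (\<lambda>(i, j). ?A' $$ (Suc i, Suc j))"
  have A3: "A3 \<in> carrier_mat k k" by (simp add: A3_def)
  have symA': "?A' $$ (i, j) = ?A' $$ (j, i)" if "i < ?n" "j < ?n" for i j
  proof -
    have "?A' $$ (i, j) = transpose_mat ?A' $$ (j, i)"
      using that W by (simp del: index_mult_mat(1))
    then show ?thesis unfolding symA' .
  qed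
  have row0: "?A' $$ (0, i) = (if i = 0 then e else 0)" if i: "i < ?n" for i
    using col0[OF i] symA'[of 0 i] i by simp
  have "transpose_mat A3 = A3"
    by (intro eq_matI) (auto simp: A3_def symA' simp del: index_mult_mat)
  then obtain R E where R: "R \<in> carrier_mat k k" and E: "E \<in> carrier_mat k k" "diagonal_mat E"
    and RR: "transpose_mat R * R = 1\<^sub>m k" and A3R: "A3 = R * E * transpose_mat R"
    using Suc.IH[OF A3] by blast
  let ?e = "mat 1 1 (\<lambda>_. e)"
  let ?b = "\<lambda>X Y :: real mat. four_block_mat X (0\<^sub>m 1 k) (0\<^sub>m k 1) Y"
  have A'b: "?A' = ?b ?e A3"
  proof (rule eq_matI)
    fix i j assume "i < dim_row (?b ?e A3)" "j < dim_col (?b ?e A3)"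
    then have ij: "i < ?n" "j < ?n" using A3 by auto
    show "?A' $$ (i, j) = ?b ?e A3 $$ (i, j)"
      using ij col0 row0 A3 by (cases i; cases j) (auto simp: A3_def simp del: index_mult_mat)
  qed (use A3 W in auto)
  have mb: "?b X Y * ?b X' Y' = ?b (X * X') (Y * Y')"
    if "X \<in> carrier_mat 1 1" "X' \<in> carrier_mat 1 1" "Y \<in> carrier_mat k k" "Y' \<in> carrier_mat k k"
    for X Y X' Y'
    using that by (subst mult_four_block_mat[of _ 1 1 _ k _ k _ _ 1 _ k]) auto
  have tb: "transpose_mat (?b X Y) = ?b (transpose_mat X) (transpose_mat Y)"
    if "X \<in> carrier_mat 1 1" "Y \<in> carrier_mat k k" for X Y
    using that by (subst transpose_four_block_mat[of _ 1 1 _ k _ k]) (auto simp: zero_transpose_mat)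
  let ?R = "?b (1\<^sub>m 1) R"
  let ?D = "?b ?e E"
  let ?Q = "W * ?R"
  have R': "?R \<in> carrier_mat ?n ?n" using four_block_carrier_mat[of "1\<^sub>m 1" 1 1 R k k] R by simp
  have D: "?D \<in> carrier_mat ?n ?n" using four_block_carrier_mat[of ?e 1 1 E k k] E by simp
  have Q: "?Q \<in> carrier_mat ?n ?n" using W R' by simp
  have R'T: "transpose_mat ?R \<in> carrier_mat ?n ?n" using R' by (simp only: transpose_carrier_mat)
  have RT: "transpose_mat ?R = ?b (1\<^sub>m 1) (transpose_mat R)" using tb[of "1\<^sub>m 1" R] R by simp
  have RR': "transpose_mat ?R * ?R = 1\<^sub>m ?n"
    unfolding RT using R RR by (subst mb) auto
  have A'R: "?A' = ?R * ?D * transpose_mat ?R"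
    unfolding A'b RT A3R using R E mb[of "1\<^sub>m 1" ?e R E]
      mb[of ?e "1\<^sub>m 1" "R * E" "transpose_mat R"] by simp
  have QT: "transpose_mat ?Q = transpose_mat ?R * transpose_mat W"
    using W R' by (simp add: transpose_mult)
  have "transpose_mat ?Q * ?Q = transpose_mat ?R * (transpose_mat W * W) * ?R"
    unfolding QT using W R' by (simp add: assoc_mult_mat[of _ ?n ?n _ ?n _ ?n])
  also have "\<dots> = 1\<^sub>m ?n" unfolding WW right_mult_one_mat[OF R'T] RR' ..
  finally have QQ: "transpose_mat ?Q * ?Q = 1\<^sub>m ?n" .
  have "?Q * ?D * transpose_mat ?Q = W * ?A' * transpose_mat W"
    unfolding QT A'R using W R' D by (simp add: assoc_mult_mat[of _ ?n ?n _ ?n _ ?n])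
  also have "\<dots> = (W * transpose_mat W) * A * (W * transpose_mat W)"
    using W A by (simp add: assoc_mult_mat[of _ ?n ?n _ ?n _ ?n])
  also have "\<dots> = A" unfolding WW' using A by simp
  finally have "A = ?Q * ?D * transpose_mat ?Q" by simp
  moreover have "diagonal_mat ?D"
    using E unfolding diagonal_mat_def by (auto simp: less_Suc_eq_0_disj; metis)
  ultimately show ?case using Q D QQ by blast
qed

section \<open>The trace principle of Ky Fan\<close>

text \<open>
  Weights in \<open>[0, 1]\<close> of total \<open>m\<close> do best on the \<open>m\<close> largest values. With the threshold
  \<open>c\<close> equal to the \<open>m\<close>-th value, the weight \<open>q i\<close> exceeds the indicator of \<open>i < m\<close> only where
  \<open>f i \<le> c\<close> and falls short of it only where \<open>f i \<ge> c\<close>; subtracting \<open>c\<close> from \<open>f\<close> costs nothing as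
  both weightings have the same total.
\<close>

lemma weighted_sum_le_sum_prefix:
  fixes f q :: "nat \<Rightarrow> real"
  assumes anti: "\<And>i j. i \<le> j \<Longrightarrow> j < n \<Longrightarrow> f j \<le> f i"
    and q: "\<And>i. i < n \<Longrightarrow> 0 \<le> q i \<and> q i \<le> 1" and sum: "(\<Sum>i<n. q i) = real m"
  shows "(\<Sum>i<n. f i * q i) \<le> (\<Sum>i<m. f i)"
proof -
  have "real m \<le> (\<Sum>i<n. 1)" unfolding sum[symmetric] using q by (intro sum_mono) auto
  then have mn: "m \<le> n" by simp
  (* For m = 0 the truncated subtraction makes c the largest value f 0; any upper bound works. *)
  define c where "c = f (m - 1)"
  let ?one = "\<lambda>i. if i < m then 1 else 0 :: real"
  have restrict: "(\<Sum>i<n. g i * ?one i) = (\<Sum>i<m. g i)" for g :: "nat \<Rightarrow> real"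
  proof -
    have "(\<Sum>i<n. g i * ?one i) = (\<Sum>i<n. if i < m then g i else 0)" by (intro sum.cong) auto
    also have "\<dots> = (\<Sum>i\<in>{..<n} \<inter> {i. i < m}. g i)" by (simp add: sum.inter_restrict[symmetric] sum.If_cases)
    also have "{..<n} \<inter> {i. i < m} = {..<m}" using mn by auto
    finally show ?thesis .
  qed
  have "(f i - c) * (q i - ?one i) \<le> 0" if i: "i < n" for i
  proof (cases "i < m")
    case True
    then have "f i \<ge> c" using anti[of i "m - 1"] mn by (auto simp: c_def)
    then show ?thesis using True q[OF i] by (simp add: mult_nonneg_nonpos)
  next
    case False
    then have "f i \<le> c" using anti[of "m - 1" i] i by (auto simp: c_def)
    then show ?thesis using False q[OF i] by (simp add: mult_nonpos_nonneg)
  qed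
  then have "(\<Sum>i<n. (f i - c) * (q i - ?one i)) \<le> 0" by (intro sum_nonpos) auto
  also have "(\<Sum>i<n. (f i - c) * (q i - ?one i))
    = (\<Sum>i<n. f i * q i) - (\<Sum>i<n. f i * ?one i) - c * ((\<Sum>i<n. q i) - (\<Sum>i<n. 1 * ?one i))"
    by (simp add: algebra_simps sum.distrib sum_subtractf sum_distrib_left)
  finally show ?thesis unfolding restrict sum by simp
qed

definition mat_trace :: "'a :: comm_monoid_add mat \<Rightarrow> 'a" where
  "mat_trace A = (\<Sum>i<dim_row A. A $$ (i, i))"

lemma mat_trace_mult:
  assumes "A \<in> carrier_mat n k" "B \<in> carrier_mat k n"
  shows "mat_trace (A * B) = (\<Sum>i<n. \<Sum>j<k. A $$ (i, j) * B $$ (j, i))"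
  using assms by (auto simp: mat_trace_def scalar_prod_def lessThan_atLeast0 intro!: sum.cong)

lemma mat_trace_mult_commute:
  fixes A B :: "'a :: comm_semiring_0 mat"
  assumes "A \<in> carrier_mat n k" "B \<in> carrier_mat k n"
  shows "mat_trace (A * B) = mat_trace (B * A)"
  unfolding mat_trace_mult[OF assms] mat_trace_mult[OF assms(2,1)]
  by (subst sum.swap) (simp add: mult.commute)

lemma proots_prod_linear_factors:
  fixes xs :: "'a :: idom list"
  shows "proots (\<Prod>x\<leftarrow>xs. [:- x, 1:]) = mset xs"
proof (induction xs)
  case (Cons x xs)
  have "(\<Prod>x\<leftarrow>xs. [:- x, 1:]) \<noteq> 0" by (auto simp: prod_list_zero_iff)
  then have "proots ([:- x, 1:] * (\<Prod>x\<leftarrow>xs. [:- x, 1:]))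
    = proots [:- x, 1:] + proots (\<Prod>x\<leftarrow>xs. [:- x, 1:])"
    by (intro proots_mult) auto
  then show ?case using Cons by simp
qed simp

text \<open>
  Ky Fan's principle. In an orthonormal eigenbasis of \<open>A\<close> the trace of \<open>A * P\<close> is the sum of the
  eigenvalues weighted by the diagonal entries of \<open>P\<close>. The bounds \<open>0 \<le> P \<le> 1\<close> put these weights
  into \<open>[0, 1]\<close>, and their total is the trace of \<open>P\<close>.
\<close>

theorem ky_fan_trace_bound:
  fixes A P :: "real mat"
  assumes A: "A \<in> carrier_mat n n" and sym: "transpose_mat A = A" and P: "P \<in> carrier_mat n n"
    and P_bounds: "\<And>x. x \<in> carrier_vec n \<Longrightarrow> 0 \<le> x \<bullet> (P *\<^sub>v x) \<and> x \<bullet> (P *\<^sub>v x) \<le> x \<bullet> x"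
    and trP: "mat_trace P = real m"
  shows "mat_trace (A * P) \<le> (\<Sum>i<m. rev (sorted_list_of_multiset (proots (char_poly A))) ! i)"
proof -
  obtain Q D where Q: "Q \<in> carrier_mat n n" and D: "D \<in> carrier_mat n n" and diag: "diagonal_mat D"
    and QQ: "transpose_mat Q * Q = 1\<^sub>m n" and AQ: "A = Q * D * transpose_mat Q"
    using real_symmetric_diagonalization[OF A sym] by blast
  have QT: "transpose_mat Q \<in> carrier_mat n n" using Q by simp
  have QQ': "Q * transpose_mat Q = 1\<^sub>m n" using mat_mult_left_right_inverse[OF QT Q QQ] .
  note assoc = assoc_mult_mat[of _ n n _ n _ n]
  let ?S = "transpose_mat Q * P * Q"
  have S: "?S \<in> carrier_mat n n" using Q P by simp
  define d where "d = diag_mat D"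
  have d: "length d = n" "\<And>i. i < n \<Longrightarrow> d ! i = D $$ (i, i)"
    using D by (auto simp: d_def diag_mat_def)
  define ls where "ls = rev (sorted_list_of_multiset (proots (char_poly A)))"
  (* The eigenvalues stand on the diagonal of D in an unknown order;
     the permutation p sorts them. *)
  have "similar_mat A D"
    unfolding similar_mat_def using similar_mat_witI[OF QQ' QQ AQ A D Q QT] by blast
  moreover have "upper_triangular D"
    using diag D unfolding diagonal_mat_def upper_triangular_def by auto
  ultimately have "char_poly A = (\<Prod>a\<leftarrow>d. [:- a, 1:])"
    unfolding d_def using char_poly_similar char_poly_upper_triangular[OF D] by metis
  then have "mset ls = mset d" unfolding ls_def by (simp add: proots_prod_linear_factors)
  then obtain p where p: "p permutes {..<n}" and ls: "permute_list p d = ls"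
    using mset_eq_permutation d(1) by metis
  have ls_nth: "ls ! i = d ! p i" if "i < n" for i
    using that p d(1) unfolding ls[symmetric] by (simp add: permute_list_nth)
  have len: "length ls = n" unfolding ls[symmetric] by (simp add: d(1))
  have pn: "p i < n" if "i < n" for i using permutes_in_image[OF p, of i] that by simp
  have S_entry: "?S $$ (i, i) = col Q i \<bullet> (P *\<^sub>v col Q i)" if "i < n" for i
    using that Q P by (simp add: assoc mult_mat_vec_def)
  have S_bounds: "0 \<le> ?S $$ (i, i) \<and> ?S $$ (i, i) \<le> 1" if i: "i < n" for i
  proof -
    have "col Q i \<bullet> col Q i = (transpose_mat Q * Q) $$ (i, i)" using i Q by simp
    then have "col Q i \<bullet> col Q i = 1" unfolding QQ using i by simp
    moreover have "col Q i \<in> carrier_vec n" using i Q by auto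
    ultimately show ?thesis using P_bounds[of "col Q i"] unfolding S_entry[OF i] by simp
  qed
  have "mat_trace ?S = mat_trace (Q * (transpose_mat Q * P))"
    using mat_trace_mult_commute[of "transpose_mat Q * P" n n Q] Q P by simp
  also have "Q * (transpose_mat Q * P) = Q * transpose_mat Q * P"
    using Q P by (simp add: assoc)
  finally have "mat_trace ?S = real m" unfolding QQ' using P trP by simp
  then have "(\<Sum>i<n. ?S $$ (i, i)) = real m" unfolding mat_trace_def carrier_matD(1)[OF S] .
  then have trS: "(\<Sum>i<n. ?S $$ (p i, p i)) = real m"
    using sum.permute[OF p, of "\<lambda>i. ?S $$ (i, i)"] by (simp add: o_def del: index_mult_mat)
  have "mat_trace (A * P) = mat_trace (Q * (D * (transpose_mat Q * P)))"
    unfolding AQ using Q P D by (simp add: assoc)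
  also have "\<dots> = mat_trace (D * (transpose_mat Q * P) * Q)"
    using Q P D by (intro mat_trace_mult_commute) auto
  also have "D * (transpose_mat Q * P) * Q = D * ?S" using Q P D by (simp add: assoc)
  also have "mat_trace (D * ?S) = (\<Sum>i<n. \<Sum>j<n. D $$ (i, j) * ?S $$ (j, i))"
    using D S by (rule mat_trace_mult)
  also have "\<dots> = (\<Sum>i<n. \<Sum>j<n. if j = i then d ! i * ?S $$ (i, i) else 0)"
    using diag D d(2) unfolding diagonal_mat_def by (intro sum.cong) (auto simp del: index_mult_mat)
  also have "\<dots> = (\<Sum>i<n. d ! i * ?S $$ (i, i))" by (simp del: index_mult_mat)
  also have "\<dots> = (\<Sum>i<n. d ! p i * ?S $$ (p i, p i))"
    using sum.permute[OF p, of "\<lambda>i. d ! i * ?S $$ (i, i)"] by (simp add: o_def del: index_mult_mat)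
  also have "\<dots> = (\<Sum>i<n. ls ! i * ?S $$ (p i, p i))"
    using ls_nth by (intro sum.cong) auto
  also have "\<dots> \<le> (\<Sum>i<m. ls ! i)"
  proof (rule weighted_sum_le_sum_prefix[OF _ _ trS])
    show "ls ! j \<le> ls ! i" if "i \<le> j" "j < n" for i j
    proof -
      have "sorted_wrt (\<ge>) ls" unfolding ls_def sorted_wrt_rev by simp
      then show ?thesis using that len by (cases "i = j") (auto simp: sorted_wrt_iff_nth_less)
    qed
  qed (use S_bounds pn in auto)
  finally show ?thesis unfolding ls_def .
qed

section \<open>Compression to single coordinates and one averaged block\<close>

text \<open>
  For disjoint \<open>U\<close> and \<open>B\<close> with \<open>B \<noteq> {}\<close> this is the orthogonal projection onto the vectors that
  are supported on \<open>U \<union> B\<close>, constant on \<open>B\<close>, and orthogonal to the indicator vector of \<open>U \<union> B\<close>: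
  the first two summands project onto the span of the unit vectors of \<open>U\<close> and of the normalised
  indicator of \<open>B\<close>, and the third one removes the direction of the indicator of \<open>U \<union> B\<close>, which
  lies in that span.
\<close>

definition aggregation_mat :: "nat \<Rightarrow> nat set \<Rightarrow> nat set \<Rightarrow> real mat" where
  "aggregation_mat n U B = mat n n (\<lambda>(i, j).
     (if i = j \<and> i \<in> U then 1 else 0)
     + (if i \<in> B \<and> j \<in> B then 1 / real (card B) else 0)
     - (if i \<in> U \<union> B \<and> j \<in> U \<union> B then 1 / real (card (U \<union> B)) else 0))"

lemma aggregation_mat_carrier [simp]: "aggregation_mat n U B \<in> carrier_mat n n"
  by (simp add: aggregation_mat_def)

lemma sum_indicator_square:
  fixes f :: "nat \<Rightarrow> nat \<Rightarrow> real"
  assumes "S \<subseteq> {..<n}"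
  shows "(\<Sum>i<n. \<Sum>j<n. f i j * (if i \<in> S \<and> j \<in> S then c else 0)) = (\<Sum>i\<in>S. \<Sum>j\<in>S. f i j) * c"
proof -
  have "(\<Sum>i<n. \<Sum>j<n. f i j * (if i \<in> S \<and> j \<in> S then c else 0))
    = (\<Sum>i\<in>S. \<Sum>j<n. f i j * (if i \<in> S \<and> j \<in> S then c else 0))"
    using assms by (intro sum.mono_neutral_right) (auto intro: sum.neutral)
  also have "\<dots> = (\<Sum>i\<in>S. \<Sum>j\<in>S. f i j * c)"
    using assms by (intro sum.cong[OF refl] sum.mono_neutral_cong_right) auto
  finally show ?thesis by (simp add: sum_distrib_right)
qed

text \<open>
  With different choices of \<open>f\<close> this evaluates the trace of the projection, its quadratic form, and
  the trace of its product with a matrix.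
\<close>

lemma sum_aggregation_mat:
  fixes f :: "nat \<Rightarrow> nat \<Rightarrow> real"
  assumes "U \<subseteq> {..<n}" "B \<subseteq> {..<n}"
  shows "(\<Sum>i<n. \<Sum>j<n. f i j * aggregation_mat n U B $$ (j, i))
    = (\<Sum>i\<in>U. f i i) + (\<Sum>i\<in>B. \<Sum>j\<in>B. f i j) / real (card B)
      - (\<Sum>i\<in>U \<union> B. \<Sum>j\<in>U \<union> B. f i j) / real (card (U \<union> B))"
proof -
  have "(\<Sum>i<n. \<Sum>j<n. f i j * (if i = j \<and> i \<in> U then 1 else 0))
      = (\<Sum>i<n. \<Sum>j<n. if j = i then (if i \<in> U then f i i else 0) else 0)"
    by (intro sum.cong refl) auto
  also have "\<dots> = (\<Sum>i<n. if i \<in> U then f i i else 0)"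
    by (intro sum.cong refl) (simp add: sum.delta)
  also have "\<dots> = (\<Sum>i\<in>U. f i i)" using assms(1) by (intro sum.mono_neutral_cong_right) auto
  finally have diag: "(\<Sum>i<n. \<Sum>j<n. f i j * (if i = j \<and> i \<in> U then 1 else 0)) = (\<Sum>i\<in>U. f i i)" .
  have "(\<Sum>i<n. \<Sum>j<n. f i j * aggregation_mat n U B $$ (j, i))
    = (\<Sum>i<n. \<Sum>j<n. f i j * (if i = j \<and> i \<in> U then 1 else 0)
        + f i j * (if i \<in> B \<and> j \<in> B then 1 / real (card B) else 0)
        - f i j * (if i \<in> U \<union> B \<and> j \<in> U \<union> B then 1 / real (card (U \<union> B)) else 0))"
    by (intro sum.cong refl) (auto simp: aggregation_mat_def algebra_simps)
  also have "\<dots> = (\<Sum>i\<in>U. f i i) + (\<Sum>i\<in>B. \<Sum>j\<in>B. f i j) * (1 / real (card B))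
      - (\<Sum>i\<in>U \<union> B. \<Sum>j\<in>U \<union> B. f i j) * (1 / real (card (U \<union> B)))"
    unfolding sum.distrib sum_subtractf diag
    using assms sum_indicator_square[of B n f] sum_indicator_square[of "U \<union> B" n f] by simp
  finally show ?thesis by simp
qed

lemma mat_trace_aggregation_mat:
  assumes "U \<subseteq> {..<n}" "B \<subseteq> {..<n}" "B \<noteq> {}"
  shows "mat_trace (aggregation_mat n U B) = real (card U)"
proof -
  have fin: "finite U" "finite B" using assms finite_subset by blast+
  have one: "(\<Sum>i\<in>S. \<Sum>j\<in>S. if i = j then 1 else 0 :: real) = real (card S)" if "finite S" for S :: "nat set"
    using that by simp
  have "mat_trace (aggregation_mat n U B)
    = (\<Sum>i<n. \<Sum>j<n. if i = j then aggregation_mat n U B $$ (j, i) else 0)"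
    by (simp add: mat_trace_def aggregation_mat_def)
  also have "\<dots> = (\<Sum>i<n. \<Sum>j<n. (if i = j then 1 else 0) * aggregation_mat n U B $$ (j, i))"
    by (intro sum.cong refl) simp
  also have "\<dots> = real (card U)"
    unfolding sum_aggregation_mat[OF assms(1,2)]
    using fin assms(3) by (subst (1 2) one) auto
  finally show ?thesis .
qed

text \<open>
  The quadratic form is \<open>(\<Sum>i\<in>U. x\<^sub>i\<^sup>2) + t\<^sup>2 / b - s\<^sup>2 / c\<close>, where \<open>t\<close> and \<open>s\<close> are the sums
  of the entries of \<open>x\<close> over \<open>B\<close> and \<open>U \<union> B\<close>, and \<open>b\<close> and \<open>c\<close> are the sizes of these sets. Both
  bounds come from the inequality of Cauchy and Schwarz: the upper one on \<open>B\<close>, and the lower one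
  on \<open>U \<union> B\<close>, after \<open>x\<close> has been averaged over \<open>B\<close>.
\<close>

lemma aggregation_mat_bounds:
  assumes U: "U \<subseteq> {..<n}" and B: "B \<subseteq> {..<n}" "B \<noteq> {}" and disj: "U \<inter> B = {}"
    and x: "x \<in> carrier_vec n"
  shows "0 \<le> x \<bullet> (aggregation_mat n U B *\<^sub>v x) \<and> x \<bullet> (aggregation_mat n U B *\<^sub>v x) \<le> x \<bullet> x"
proof -
  have fin: "finite U" "finite B" using assms finite_subset by blast+
  let ?b = "real (card B)" and ?c = "real (card (U \<union> B))"
  let ?t = "\<Sum>i\<in>B. x $ i"
  let ?X = "\<Sum>i\<in>U. (x $ i)\<^sup>2"
  have b: "?b > 0" using fin B by (simp add: card_gt_0_iff)
  have c: "?c > 0" using fin B by (simp add: card_gt_0_iff)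
  have "x \<bullet> (aggregation_mat n U B *\<^sub>v x)
    = (\<Sum>i<n. \<Sum>j<n. (x $ i * x $ j) * aggregation_mat n U B $$ (i, j))"
    using x by (simp add: scalar_prod_def lessThan_atLeast0 sum_distrib_left mult_ac aggregation_mat_def)
  also have "\<dots> = (\<Sum>i<n. \<Sum>j<n. (x $ j * x $ i) * aggregation_mat n U B $$ (j, i))"
    by (rule sum.swap)
  also have "\<dots> = (\<Sum>i\<in>U. x $ i * x $ i) + (\<Sum>i\<in>B. \<Sum>j\<in>B. x $ j * x $ i) / ?b
      - (\<Sum>i\<in>U \<union> B. \<Sum>j\<in>U \<union> B. x $ j * x $ i) / ?c"
    using U B by (simp add: sum_aggregation_mat)
  also have "\<dots> = ?X + ?t\<^sup>2 / ?b - (\<Sum>i\<in>U \<union> B. x $ i)\<^sup>2 / ?c"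
    by (simp add: power2_eq_square sum_product mult.commute)
  finally have form: "x \<bullet> (aggregation_mat n U B *\<^sub>v x) = \<dots>" .
  have "(\<Sum>i\<in>U \<union> B. x $ i)\<^sup>2 / ?c \<le> ?X + ?t\<^sup>2 / ?b"
  proof -
    (* Averaging over B preserves the sum s and turns the sum of squares into
       the first two summands of the form. *)
    let ?y = "\<lambda>i. if i \<in> U then x $ i else ?t / ?b"
    have split: "(\<Sum>i\<in>U \<union> B. g (?y i)) = (\<Sum>i\<in>U. g (x $ i)) + ?b * g (?t / ?b)" for g :: "real \<Rightarrow> real"
    proof -
      have "(\<Sum>i\<in>B. g (?y i)) = (\<Sum>i\<in>B. g (?t / ?b))" using disj by (intro sum.cong) auto
      then show ?thesis by (simp add: sum.union_disjoint[OF fin disj])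
    qed
    have "(\<Sum>i\<in>U \<union> B. ?y i) = (\<Sum>i\<in>U \<union> B. x $ i)"
      using b split[of "\<lambda>z. z"] by (simp add: sum.union_disjoint[OF fin disj])
    moreover have "(\<Sum>i\<in>U \<union> B. (?y i)\<^sup>2) = ?X + ?t\<^sup>2 / ?b"
      using b split[of "\<lambda>z. z\<^sup>2"] by (simp add: power2_eq_square)
    ultimately have "(\<Sum>i\<in>U \<union> B. x $ i)\<^sup>2 \<le> (?X + ?t\<^sup>2 / ?b) * ?c"
      using sum_squared_le_sum_of_squares[of "?y" "U \<union> B"] by simp
    then show ?thesis using c by (simp add: divide_le_eq)
  qed
  moreover have "?X + ?t\<^sup>2 / ?b - (\<Sum>i\<in>U \<union> B. x $ i)\<^sup>2 / ?c \<le> x \<bullet> x"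
  proof -
    have "?t\<^sup>2 / ?b \<le> (\<Sum>i\<in>B. (x $ i)\<^sup>2)"
      using b sum_squared_le_sum_of_squares[of "\<lambda>i. x $ i" B] by (simp add: divide_le_eq)
    then have "?X + ?t\<^sup>2 / ?b \<le> (\<Sum>i\<in>U \<union> B. (x $ i)\<^sup>2)"
      by (simp add: sum.union_disjoint[OF fin disj])
    also have "\<dots> \<le> (\<Sum>i<n. (x $ i)\<^sup>2)" using U B by (intro sum_mono2) auto
    also have "\<dots> = x \<bullet> x"
      using x by (simp add: scalar_prod_def lessThan_atLeast0 power2_eq_square)
    finally show ?thesis using c by (smt (verit) divide_nonneg_nonneg zero_le_power2)
  qed
  ultimately show ?thesis unfolding form by simp
qed

text \<open>
  Compressing \<open>A\<close> to the span of the unit vectors of \<open>U\<close> and one averaged vector would involve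
  \<open>card U + 1\<close> eigenvalues. Removing the indicator direction of \<open>U \<union> B\<close> leaves a space of
  dimension \<open>card U\<close>, at the price of the negative term. This is the right direction to remove from
  a Laplacian, whose form at an indicator vector only sees the arcs that leave the set.
\<close>

theorem eigenvalue_sum_aggregation_bound:
  fixes A :: "real mat"
  assumes A: "A \<in> carrier_mat n n" "transpose_mat A = A"
    and U: "U \<subseteq> {..<n}" and B: "B \<subseteq> {..<n}" "B \<noteq> {}" and disj: "U \<inter> B = {}"
  shows "(\<Sum>i\<in>U. A $$ (i, i)) + (\<Sum>i\<in>B. \<Sum>j\<in>B. A $$ (i, j)) / real (card B)
      - (\<Sum>i\<in>U \<union> B. \<Sum>j\<in>U \<union> B. A $$ (i, j)) / real (card (U \<union> B))
    \<le> (\<Sum>i<card U. rev (sorted_list_of_multiset (proots (char_poly A))) ! i)"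
proof -
  have "mat_trace (A * aggregation_mat n U B)
    \<le> (\<Sum>i<card U. rev (sorted_list_of_multiset (proots (char_poly A))) ! i)"
    using A aggregation_mat_carrier aggregation_mat_bounds[OF U B disj]
      mat_trace_aggregation_mat[OF U B]
    by (rule ky_fan_trace_bound)
  then show ?thesis
    unfolding mat_trace_mult[OF A(1) aggregation_mat_carrier] sum_aggregation_mat[OF U B(1)] .
qed

section \<open>Counting arcs between sets of vertices\<close>

definition adjacent :: "'a pair_pre_digraph \<Rightarrow> 'a \<Rightarrow> 'a \<Rightarrow> real" where
  "adjacent G u v = (if (u, v) \<in> parcs G then 1 else 0)"

text \<open>
  Arcs are counted as a double sum over vertices, the form in which entries of the Laplacian appear.
\<close>

definition arc_count :: "'a pair_pre_digraph \<Rightarrow> 'a set \<Rightarrow> 'a set \<Rightarrow> real" where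
  "arc_count G S T = (\<Sum>u\<in>S. \<Sum>v\<in>T. adjacent G u v)"

lemma arc_count_nonneg: "arc_count G S T \<ge> 0"
  by (auto simp: arc_count_def adjacent_def intro!: sum_nonneg)

lemma arc_count_eq_0:
  assumes "\<And>u v. u \<in> S \<Longrightarrow> v \<in> T \<Longrightarrow> (u, v) \<notin> parcs G"
  shows "arc_count G S T = 0"
  using assms by (simp add: arc_count_def adjacent_def)

lemma arc_count_Un_left:
  assumes "finite S" "finite S'" "S \<inter> S' = {}"
  shows "arc_count G (S \<union> S') T = arc_count G S T + arc_count G S' T"
  using assms by (simp add: arc_count_def sum.union_disjoint)

lemma arc_count_Un_right:
  assumes "finite T" "finite T'" "T \<inter> T' = {}"
  shows "arc_count G S (T \<union> T') = arc_count G S T + arc_count G S T'"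
  using assms by (simp add: arc_count_def sum.union_disjoint sum.distrib)

lemma arc_count_eq_card:
  assumes "finite S" "finite T"
  shows "arc_count G S T = real (card (parcs G \<inter> S \<times> T))"
proof -
  have "arc_count G S T = (\<Sum>e\<in>S \<times> T. if e \<in> parcs G then 1 else 0)"
    by (simp add: arc_count_def adjacent_def sum.cartesian_product case_prod_unfold)
  also have "\<dots> = (\<Sum>e\<in>parcs G \<inter> S \<times> T. 1)"
    using assms by (intro sum.mono_neutral_cong_right) auto
  finally show ?thesis by simp
qed

context pair_graph
begin

lemma arc_count_commute: "arc_count G S T = arc_count G T S"
proof -
  have "adjacent G u v = adjacent G v u" for u v
    using arcs_symmetric unfolding adjacent_def by auto
  then show ?thesis unfolding arc_count_def by (subst sum.swap) simp
qed

lemma out_degree_eq_sum_adjacent: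
  "real (out_degree (with_proj G) u) = (\<Sum>v\<in>pverts G. adjacent G u v)"
proof -
  have "out_degree (with_proj G) u = card {e \<in> parcs G. fst e = u}"
    by (simp add: out_degree_def out_arcs_def)
  also have "\<dots> = card {v \<in> pverts G. (u, v) \<in> parcs G}"
    by (rule bij_betw_same_card[of snd], rule bij_betwI[of _ _ _ "Pair u"])
      (auto dest: in_arcsD2)
  finally show ?thesis
    using pair_finite_verts by (simp add: adjacent_def sum.If_cases Int_def)
qed

lemma card_edge_boundary:
  assumes "U \<subseteq> pverts G"
  shows "real (card (edge_boundary G U)) = arc_count G U (pverts G - U)"
proof -
  let ?E = "parcs G \<inter> U \<times> (pverts G - U)"
  have fin: "finite U" using assms pair_finite_verts finite_subset by blast
  have "edge_boundary G U = (\<lambda>(u, v). {u, v}) ` ?E"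
    by (auto simp: edge_boundary_def image_iff)
  moreover have "inj_on (\<lambda>(u, v). {u, v}) ?E"
    by (auto simp: inj_on_def doubleton_eq_iff)
  ultimately show ?thesis
    using fin pair_finite_verts by (simp add: card_image arc_count_eq_card)
qed

text \<open>
  A set without vertex boundary is closed under walking along arcs, so a walk that starts in it
  cannot reach a vertex outside.
\<close>

lemma vertex_boundary_nonempty:
  assumes conn: "Digraph_Component.connected (with_proj G)"
    and U: "U \<subset> pverts G" "U \<noteq> {}"
  shows "vertex_boundary G U \<noteq> {}"
proof
  assume empty: "vertex_boundary G U = {}"
  obtain u v where uv: "u \<in> U" "v \<in> pverts G - U" using U by blast
  have "strongly_connected (with_proj G)"
    using symmetric_connected_imp_strongly_connected[OF pair_sym_arcs conn] .
  then have "u \<rightarrow>\<^sup>*\<^bsub>with_proj G\<^esub> v" using uv U unfolding strongly_connected_def by auto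
  then have "v \<in> U"
    unfolding reachable_def
  proof (induction rule: rtrancl_on_induct)
    case base
    show ?case using uv by simp
  next
    case (step y z)
    then show ?case using empty unfolding vertex_boundary_def by auto
  qed
  then show False using uv by simp
qed

context
  fixes vs :: "'a list"
  assumes vs: "vertex_numbering G vs"
begin

lemma laplacian_mat_carrier: "laplacian_mat G vs \<in> carrier_mat (length vs) (length vs)"
  by (auto simp: laplacian_mat_def degree_mat_def adjacency_mat_def intro!: minus_carrier_mat)

lemma laplacian_mat_entry:
  assumes "i < length vs" "j < length vs"
  shows "laplacian_mat G vs $$ (i, j) =
    (if vs ! i = vs ! j then real (out_degree (with_proj G) (vs ! i)) else 0)
      - adjacent G (vs ! i) (vs ! j)"
  using assms vs nth_eq_iff_index_eq[of vs i j]
  by (auto simp: laplacian_mat_def degree_mat_def adjacency_mat_def adjacent_def vertex_numbering_def)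

lemma laplacian_mat_symmetric: "transpose_mat (laplacian_mat G vs) = laplacian_mat G vs"
proof (rule eq_matI)
  fix i j assume "i < dim_row (laplacian_mat G vs)" "j < dim_col (laplacian_mat G vs)"
  then have "i < length vs" "j < length vs" using laplacian_mat_carrier by auto
  then show "transpose_mat (laplacian_mat G vs) $$ (i, j) = laplacian_mat G vs $$ (i, j)"
    using laplacian_mat_carrier arcs_symmetric
    by (auto simp: laplacian_mat_entry adjacent_def)
qed (use laplacian_mat_carrier in auto)

lemma vertex_indices_bij_betw:
  assumes "S \<subseteq> pverts G"
  shows "bij_betw ((!) vs) {i. i < length vs \<and> vs ! i \<in> S} S"
proof (rule bij_betw_imageI)
  show "inj_on ((!) vs) {i. i < length vs \<and> vs ! i \<in> S}"
    using vs by (auto simp: inj_on_def vertex_numbering_def nth_eq_iff_index_eq)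
  show "(!) vs ` {i. i < length vs \<and> vs ! i \<in> S} = S"
    using vs assms by (auto simp: vertex_numbering_def in_set_conv_nth image_iff) (metis in_set_conv_nth subsetD)
qed

text \<open>
  The Laplacian form of the indicator vector of \<open>S\<close> counts the arcs that leave \<open>S\<close>: each row
  contributes the degree of its vertex minus the number of its neighbours inside \<open>S\<close>.
\<close>

lemma sum_laplacian_mat_square:
  assumes S: "S \<subseteq> pverts G"
  defines "I \<equiv> {i. i < length vs \<and> vs ! i \<in> S}"
  shows "(\<Sum>i\<in>I. \<Sum>j\<in>I. laplacian_mat G vs $$ (i, j)) = arc_count G S (pverts G - S)"
proof -
  let ?deg = "\<lambda>u. real (out_degree (with_proj G) u)"
  have fin: "finite S" using S pair_finite_verts finite_subset by blast
  have bij: "bij_betw ((!) vs) I S" unfolding I_def by (rule vertex_indices_bij_betw[OF S])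
  have "(\<Sum>i\<in>I. \<Sum>j\<in>I. laplacian_mat G vs $$ (i, j))
    = (\<Sum>i\<in>I. \<Sum>j\<in>I. (if vs ! i = vs ! j then ?deg (vs ! i) else 0) - adjacent G (vs ! i) (vs ! j))"
    by (intro sum.cong refl) (auto simp: I_def laplacian_mat_entry)
  also have "\<dots> = (\<Sum>u\<in>S. \<Sum>v\<in>S. (if u = v then ?deg u else 0) - adjacent G u v)"
    unfolding sum.reindex_bij_betw[OF bij, of "\<lambda>v. (if _ = v then ?deg _ else 0) - adjacent G _ v"]
    by (rule sum.reindex_bij_betw[OF bij])
  also have "\<dots> = (\<Sum>u\<in>S. ?deg u - (\<Sum>v\<in>S. adjacent G u v))"
    using fin by (simp add: sum_subtractf)
  also have "\<dots> = arc_count G S (pverts G - S)"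
    unfolding arc_count_def out_degree_eq_sum_adjacent
    using pair_finite_verts S by (simp add: sum_diff)
  finally show ?thesis .
qed

lemma sum_laplacian_mat_diagonal:
  assumes S: "S \<subseteq> pverts G"
  defines "I \<equiv> {i. i < length vs \<and> vs ! i \<in> S}"
  shows "(\<Sum>i\<in>I. laplacian_mat G vs $$ (i, i)) = (\<Sum>u\<in>S. real (out_degree (with_proj G) u))"
proof -
  have "(\<Sum>i\<in>I. laplacian_mat G vs $$ (i, i)) = (\<Sum>i\<in>I. real (out_degree (with_proj G) (vs ! i)))"
    using no_loops' by (intro sum.cong refl) (auto simp: I_def laplacian_mat_entry adjacent_def)
  also have "\<dots> = (\<Sum>u\<in>S. real (out_degree (with_proj G) u))"
    unfolding I_def by (rule sum.reindex_bij_betw[OF vertex_indices_bij_betw[OF S]])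
  finally show ?thesis .
qed

text \<open>
  Here the set that is averaged over is the vertex boundary \<open>B\<close>, and \<open>W\<close> collects the vertices
  outside \<open>U \<union> B\<close>. No arc joins \<open>U\<close> to \<open>W\<close>, so the arcs leaving \<open>B\<close> are those to \<open>U\<close>, which
  give the edge boundary, and those to \<open>W\<close>, which are also all the arcs leaving \<open>U \<union> B\<close>. The
  latter are added with weight \<open>1 / card B\<close> and subtracted with the smaller weight
  \<open>1 / card (U \<union> B)\<close>.
\<close>

theorem laplacian_eigenvalue_sum_ge:
  assumes U: "U \<subseteq> pverts G" and B0: "vertex_boundary G U \<noteq> {}"
  shows "(\<Sum>i = 1..card U. laplacian_eigenvalue G vs i)
    \<ge> (\<Sum>u\<in>U. real (out_degree (with_proj G) u))
      + real (card (edge_boundary G U)) / real (card (vertex_boundary G U))"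
proof -
  define B where "B = vertex_boundary G U"
  define W where "W = pverts G - U - B"
  have B: "B \<subseteq> pverts G" "B \<inter> U = {}" "B \<noteq> {}" using B0 by (auto simp: B_def vertex_boundary_def)
  have fin: "finite U" "finite B" "finite W"
    using U B pair_finite_verts finite_subset unfolding W_def by blast+
  define idx where "idx S = {i. i < length vs \<and> vs ! i \<in> S}" for S
  have card_idx: "card (idx S) = card S" if "S \<subseteq> pverts G" for S
    unfolding idx_def using vertex_indices_bij_betw[OF that] by (rule bij_betw_same_card)
  have square: "(\<Sum>i\<in>idx S. \<Sum>j\<in>idx S. laplacian_mat G vs $$ (i, j)) = arc_count G S (pverts G - S)"
    if "S \<subseteq> pverts G" for S
    unfolding idx_def by (rule sum_laplacian_mat_square[OF that])
  have diagonal: "(\<Sum>i\<in>idx U. laplacian_mat G vs $$ (i, i)) = (\<Sum>u\<in>U. real (out_degree (with_proj G) u))"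
    unfolding idx_def by (rule sum_laplacian_mat_diagonal[OF U])
  have idx_Un: "idx U \<union> idx B = idx (U \<union> B)" by (auto simp: idx_def)
  have "idx B \<noteq> {}" using card_idx[OF B(1)] B(3) fin by (metis card.empty card_eq_0_iff)
  moreover have "idx U \<inter> idx B = {}" "idx U \<subseteq> {..<length vs}" "idx B \<subseteq> {..<length vs}"
    using B by (auto simp: idx_def)
  ultimately have
    "(\<Sum>u\<in>U. real (out_degree (with_proj G) u))
      + arc_count G B (pverts G - B) / real (card B)
      - arc_count G (U \<union> B) (pverts G - (U \<union> B)) / real (card (U \<union> B))
    \<le> (\<Sum>i<card U. rev (sorted_list_of_multiset (proots (char_poly (laplacian_mat G vs)))) ! i)"
    (is "?lower \<le> ?upper")
    using eigenvalue_sum_aggregation_bound[OF laplacian_mat_carrier laplacian_mat_symmetric, of "idx U" "idx B"]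
      U B by (simp add: idx_Un card_idx square diagonal)
  also have "?upper = (\<Sum>i = 1..card U. laplacian_eigenvalue G vs i)"
    unfolding laplacian_eigenvalue_def by (rule sum.reindex_bij_witness[of _ "\<lambda>i. i - 1" Suc]) auto
  finally have bound: "?lower \<le> (\<Sum>i = 1..card U. laplacian_eigenvalue G vs i)" .
  have UW: "arc_count G U W = 0"
    by (rule arc_count_eq_0) (auto simp: W_def B_def vertex_boundary_def)
  have "pverts G - B = U \<union> W" "U \<inter> W = {}" using U B by (auto simp: W_def)
  then have cut_B: "arc_count G B (pverts G - B) = arc_count G U B + arc_count G B W"
    using fin arc_count_Un_right[of U W G B] arc_count_commute[of B U] by simp
  have "pverts G - (U \<union> B) = W" by (auto simp: W_def)
  then have cut_UB: "arc_count G (U \<union> B) (pverts G - (U \<union> B)) = arc_count G B W"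
    using fin B UW arc_count_Un_left[of U B G W] by auto
  have "pverts G - U = B \<union> W" "B \<inter> W = {}" using B by (auto simp: W_def)
  then have boundary: "real (card (edge_boundary G U)) = arc_count G U B"
    using fin UW card_edge_boundary[OF U] arc_count_Un_right[of B W G U] by simp
  have "arc_count G B W / real (card (U \<union> B)) \<le> arc_count G B W / real (card B)"
    using fin B by (intro divide_left_mono arc_count_nonneg) (auto simp: card_mono card_gt_0_iff)
  then show ?thesis
    using bound unfolding cut_B cut_UB boundary B_def[symmetric] by (simp add: add_divide_distrib)
qed

end

end

theorem theorem2p3:
  fixes G :: "'a pair_pre_digraph" and vs :: "'a list" and U :: "'a set" and m n :: nat
  assumes "pair_graph G"
    and "Digraph_Component.connected (with_proj G)"
    and "n = card (pverts G)"
    and "vertex_numbering G vs"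
    and "U \<subseteq> pverts G"
    and "card U = m"
    and "0 < m" and "m < n"
  shows "(\<Sum>i = 1..m. laplacian_eigenvalue G vs i)
    \<ge> (\<Sum>u\<in>U. real (out_degree (with_proj G) u))
      + real (card (edge_boundary G U)) / real (card (vertex_boundary G U))"
proof -
  interpret pair_graph G by fact
  have "U \<subset> pverts G" "U \<noteq> {}" using assms(3,5-8) by auto
  then have "vertex_boundary G U \<noteq> {}" using vertex_boundary_nonempty[OF assms(2)] by blast
  then show ?thesis using laplacian_eigenvalue_sum_ge[OF assms(4,5)] assms(6) by simp
qed

end
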